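(* Let $R\ge 2$ be an integer and let $(B,L)$ be a Hadamard pair with scaling factor $R$. Assume that all extreme cycles for $(B,L)$ are contained in $\mathbb{Z}$. Let $\Lambda(L)$ be the smallest subset of $\mathbb{R}$ which contains $-C$ for every cycle $C$ for $L$ that is extreme for $(B,L)$, and which satisfies $R\Lambda(L)+L\subset\Lambda(L)$. Then $\Lambda(L)$ is the set of all integers which can be represented in base $R$ using digits in $L$.
   Context: Hadamard pair: let $R\ge2$ be an integer (the scaling factor) and let $B,L$ be finite subsets of $\mathbb{Z}$ with $0\in B$, $0\in L$. $(B,L)$ is a Hadamard pair with scaling factor $R$ if $\#B=\#L=N$ and the matrix $\frac{1}{\sqrt N}\left(e^{2\pi i R^{-1}bl}\right)_{b\in B,l\in L}$ is unitary. Put $m_B(x)=\frac1N\sum_{b\in B}e^{2\pi i bx}$ for $x\in\mathbb{R}$. Cycles: a finite set $\{x_0,\dots,x_{r-1}\}$ of real numbers is a cycle for $L$ if there exist $l_0,\dots,l_{r-1}\in L$ with $\frac{x_0+l_0}{R}=x_1,\ \dots,\ \frac{x_{r-2}+l_{r-2}}{R}=x_{r-1},\ \frac{x_{r-1}+l_{r-1}}{R}=x_0$. The cycle is extreme for $(B,L)$ if $|m_B(x_k)|=1$ for all $k$. Representation: an integer $x$ can be represented in base $R$ using digits in $L$ if there exist integers $x_0=x,x_1,x_2,\dots$ and digits $l_0,l_1,\dots\in L$ such that $x_k=Rx_{k+1}+l_k$ for all $k\ge0$. Notation: $R\Lambda+L=\{R\lambda+l:\lambda\in\Lambda,\ l\in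 L\}$ and $-C=\{-c: c\in C\}$. *)

theory Defs
  imports "HOL-Analysis.Analysis"
begin

(* Matrices with finite index sets I (rows) and J (columns), as functions of two indices;
   the two conditions are U U* = 1 and U* U = 1. *)
definition unitary_on :: "'i set \<Rightarrow> 'j set \<Rightarrow> ('i \<Rightarrow> 'j \<Rightarrow> complex) \<Rightarrow> bool" where
  "unitary_on I J U \<longleftrightarrow>
     (\<forall>i\<in>I. \<forall>i'\<in>I. (\<Sum>j\<in>J. U i j * cnj (U i' j)) = (if i = i' then 1 else 0)) \<and>
     (\<forall>j\<in>J. \<forall>j'\<in>J. (\<Sum>i\<in>I. cnj (U i j) * U i j') = (if j = j' then 1 else 0))"

definition Hadamard_pair :: "int \<Rightarrow> int set \<Rightarrow> int set \<Rightarrow> bool" where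
  "Hadamard_pair R B L \<longleftrightarrow>
     R \<ge> 2 \<and> finite B \<and> finite L \<and> 0 \<in> B \<and> 0 \<in> L \<and> card B = card L \<and>
     unitary_on B L (\<lambda>b l. 1 / complex_of_real (sqrt (real (card B))) *
       exp (2 * complex_of_real pi * \<i> * (of_int b * of_int l / of_int R)))"

definition m_fun :: "int set \<Rightarrow> real \<Rightarrow> complex" where
  "m_fun B x = 1 / of_nat (card B) *
     (\<Sum>b\<in>B. exp (2 * complex_of_real pi * \<i> * of_int b * complex_of_real x))"

(* The points x 0, ..., x (r - 1) need not be distinct. *)
definition is_cycle :: "int \<Rightarrow> int set \<Rightarrow> real set \<Rightarrow> bool" where
  "is_cycle R L C \<longleftrightarrow>
     (\<exists>(r::nat) (x :: nat \<Rightarrow> real) (l :: nat \<Rightarrow> int).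
        r \<ge> 1 \<and> C = x ` {..<r} \<and>
        (\<forall>k<r. l k \<in> L \<and> (x k + of_int (l k)) / of_int R = x ((k + 1) mod r)))"

definition extreme_cycle :: "int \<Rightarrow> int set \<Rightarrow> int set \<Rightarrow> real set \<Rightarrow> bool" where
  "extreme_cycle R B L C \<longleftrightarrow> is_cycle R L C \<and> (\<forall>x\<in>C. norm (m_fun B x) = 1)"

definition Lambda_admissible :: "int \<Rightarrow> int set \<Rightarrow> int set \<Rightarrow> real set \<Rightarrow> bool" where
  "Lambda_admissible R B L S \<longleftrightarrow>
     (\<forall>C. extreme_cycle R B L C \<longrightarrow> uminus ` C \<subseteq> S) \<and>
     {of_int R * s + of_int l | s l. s \<in> S \<and> l \<in> L} \<subseteq> S"

definition Lambda_set :: "int \<Rightarrow> int set \<Rightarrow> int set \<Rightarrow> real set" where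
  "Lambda_set R B L = \<Inter> {S. Lambda_admissible R B L S}"

(* The smallest admissible set exists, so the intersection is that set. *)
lemma Lambda_set_admissible: "Lambda_admissible R B L (Lambda_set R B L)"
  unfolding Lambda_admissible_def
proof (intro conjI allI impI subsetI)
  fix C x assume "extreme_cycle R B L C" "x \<in> uminus ` C"
  then have "x \<in> S" if "Lambda_admissible R B L S" for S
    using that unfolding Lambda_admissible_def by (meson subsetD)
  then show "x \<in> Lambda_set R B L"
    by (simp add: Lambda_set_def)
next
  fix x assume "x \<in> {of_int R * s + of_int l | s l. s \<in> Lambda_set R B L \<and> l \<in> L}"
  then obtain s l where x: "x = of_int R * s + of_int l"
    and s: "s \<in> Lambda_set R B L" and l: "l \<in> L" by auto
  have "x \<in> S" if S: "Lambda_admissible R B L S" for S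
  proof -
    from s S have "s \<in> S" by (simp add: Lambda_set_def)
    with x l have "x \<in> {of_int R * s + of_int l | s l. s \<in> S \<and> l \<in> L}" by auto
    moreover from S have "{of_int R * s + of_int l | s l. s \<in> S \<and> l \<in> L} \<subseteq> S"
      unfolding Lambda_admissible_def by (rule conjunct2)
    ultimately show ?thesis by (rule rev_subsetD)
  qed
  then show "x \<in> Lambda_set R B L"
    by (simp add: Lambda_set_def)
qed

lemma Lambda_set_least: "Lambda_admissible R B L S \<Longrightarrow> Lambda_set R B L \<subseteq> S"
  unfolding Lambda_set_def by (rule Inter_lower) simp

definition representable :: "int \<Rightarrow> int set \<Rightarrow> int \<Rightarrow> bool" where
  "representable R L x \<longleftrightarrow>
     (\<exists>(y :: nat \<Rightarrow> int) (l :: nat \<Rightarrow> int).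
        y 0 = x \<and> (\<forall>k. l k \<in> L \<and> y k = R * y (Suc k) + l k))"

end

theory Submission
  imports Defs
begin

(* A digit expansion y k = R * y (k + 1) + l k is bounded, since R \<ge> 2 and L is finite, so it
   revisits a value: y i = y j with i < j. Then the points -y i, ..., -y (j - 1) form a cycle, which
   is extreme because m_B = 1 on the integers; so y i lies in Lambda(L), and applying
   s \<mapsto> R s + l repeatedly leads back to y 0. Conversely, an integral cycle through x is a periodic
   expansion of -x, and R s + l prepends the digit l to an expansion of s. *)

text \<open>Every exponent is an integer multiple of \<open>2 * pi * \<i>\<close>, so
  \<open>m_fun\<close> is an average of ones; \<open>B \<noteq> {}\<close> keeps the division
  meaningful.\<close>

lemma m_fun_of_int:
  assumes "finite B" and "B \<noteq> {}"
  shows "m_fun B (of_int n) = 1"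
proof -
  have "exp (2 * complex_of_real pi * \<i> * of_int b * complex_of_real (of_int n)) = 1" for b
  proof -
    have "2 * complex_of_real pi * \<i> * of_int b * complex_of_real (of_int n)
        = of_int (2 * (b * n)) * complex_of_real pi * \<i>"
      by simp
    then show ?thesis
      unfolding exp_eq_1 by (auto intro!: exI[of _ "b * n"])
  qed
  then show ?thesis
    using assms by (simp add: m_fun_def)
qed

lemma extreme_cycle_of_int:
  assumes "is_cycle R L C" "C \<subseteq> \<int>" "finite B" "B \<noteq> {}"
  shows "extreme_cycle R B L C"
  using assms m_fun_of_int[of B] by (auto simp: extreme_cycle_def elim!: Ints_cases dest!: subsetD)

text \<open>\<open>case_nat\<close> puts the new value and the new digit in front of the old
  sequences; every later equation is an old one with its index shifted by one.\<close>

lemma representable_prepend: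
  assumes "representable R L x" and "l \<in> L"
  shows "representable R L (R * x + l)"
proof -
  obtain y d where y: "y 0 = x" "\<And>k. d k \<in> L \<and> y k = R * y (Suc k) + d k"
    using assms(1) unfolding representable_def by blast
  show ?thesis
    unfolding representable_def
  proof (intro exI conjI allI)
    show "case_nat (R * x + l) y 0 = R * x + l"
      by simp
    fix k
    show "case_nat l d k \<in> L"
      using y(2) assms(2) by (cases k) simp_all
    show "case_nat (R * x + l) y k = R * case_nat (R * x + l) y (Suc k) + case_nat l d k"
    proof (cases k)
      case (Suc n)
      then show ?thesis
        using y(2)[of n] by simp
    qed (simp add: y(1))
  qed
qed

text \<open>The relation \<open>(x k + l k) / R = x (k + 1)\<close> rearranges to
  \<open>- x k = R * (- x (k + 1)) + l k\<close>, so running round the cycle forever gives a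
  periodic expansion.\<close>

lemma is_cycle_imp_representable:
  assumes R: "R \<noteq> 0" and C: "is_cycle R L C" "C \<subseteq> \<int>" and c: "of_int c \<in> C"
  shows "representable R L (- c)"
proof -
  obtain r :: nat and x l where r: "r \<ge> 1" and Cx: "C = x ` {..<r}"
    and x: "\<forall>k<r. l k \<in> L \<and> (x k + of_int (l k)) / of_int R = x ((k + 1) mod r)"
    using C(1) unfolding is_cycle_def by blast
  obtain i where i: "i < r" "x i = of_int c"
    using c Cx by auto
  \<comment> \<open>The shift by \<open>i\<close> makes the sequence start at \<open>- c\<close>. On
    integral points the floor merely converts from real to int.\<close>
  define y where "y k = - \<lfloor>x ((i + k) mod r)\<rfloor>" for k
  have "l ((i + k) mod r) \<in> L \<and> y k = R * y (Suc k) + l ((i + k) mod r)" for k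
  proof -
    have lt: "(i + k) mod r < r" "((i + k) mod r + 1) mod r < r"
      using r by auto
    have "x ((i + k) mod r) \<in> \<int>" "x (((i + k) mod r + 1) mod r) \<in> \<int>"
      using C(2) Cx lt by auto
    then obtain u v where uv: "x ((i + k) mod r) = of_int u"
        "x (((i + k) mod r + 1) mod r) = of_int v"
      by (auto elim!: Ints_cases)
    have "real_of_int (u + l ((i + k) mod r)) = of_int (v * R)"
      using x[rule_format, OF lt(1)] uv R by (simp add: field_simps)
    then have "u + l ((i + k) mod r) = v * R"
      by (simp only: of_int_eq_iff)
    moreover have "y k = - u" "y (Suc k) = - v"
      using uv by (simp_all add: y_def mod_Suc_eq)
    ultimately show ?thesis
      using x lt(1) by (simp add: algebra_simps)
  qed
  moreover have "y 0 = - c"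
    using i by (simp add: y_def)
  ultimately show ?thesis
    unfolding representable_def
    by (intro exI[of _ y] exI[of _ "\<lambda>k. l ((i + k) mod r)"] conjI allI) blast+
qed

text \<open>The bound reproduces itself: \<open>R\<close> times the absolute value of
  \<open>y (Suc k)\<close> is at most \<open>K + M \<le> 2 * K\<close>, and \<open>R \<ge> 2\<close>
  absorbs the factor 2.\<close>

lemma expansion_bounded:
  fixes R :: int and y d :: "nat \<Rightarrow> int"
  assumes R: "R \<ge> 2" and y: "\<And>k. y k = R * y (Suc k) + d k"
    and d: "\<And>k. \<bar>d k\<bar> \<le> M" and y0: "\<bar>y 0\<bar> \<le> K" and "M \<le> K"
  shows "\<bar>y k\<bar> \<le> K"
proof (induction k)
  case (Suc k)
  have "R * \<bar>y (Suc k)\<bar> = \<bar>y k - d k\<bar>"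
    using R y[of k] by (simp add: abs_mult)
  also have "\<dots> \<le> 2 * K"
    using Suc d[of k] \<open>M \<le> K\<close> by linarith
  finally have "R * \<bar>y (Suc k)\<bar> \<le> 2 * K" .
  moreover have "2 * \<bar>y (Suc k)\<bar> \<le> R * \<bar>y (Suc k)\<bar>"
    using R by (intro mult_right_mono) auto
  ultimately show ?case
    by linarith
qed (use y0 in simp)

text \<open>Pigeonhole: a bounded sequence of integers has finite range and cannot be injective on
  the naturals.\<close>

lemma expansion_repeats:
  fixes R :: int and y d :: "nat \<Rightarrow> int"
  assumes R: "R \<ge> 2" and y: "\<And>k. y k = R * y (Suc k) + d k"
    and d: "range d \<subseteq> L" "finite L"
  obtains i j where "i < j" "y i = y j"
proof -
  have "finite (abs ` L)"
    using d(2) by simp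
  then obtain M where M: "\<And>l. l \<in> L \<Longrightarrow> \<bar>l\<bar> \<le> M"
    using bdd_above_finite by (fastforce simp: bdd_above_def)
  have dM: "\<bar>d k\<bar> \<le> M" for k
    using M d(1) by auto
  have "\<bar>y k\<bar> \<le> max M \<bar>y 0\<bar>" for k
    by (rule expansion_bounded[of R y d M, OF R y dM]) simp_all
  then have "range y \<subseteq> {- max M \<bar>y 0\<bar>..max M \<bar>y 0\<bar>}"
    unfolding abs_le_iff by (auto simp del: le_max_iff_disj simp: minus_le_iff)
  then have "finite (range y)"
    by (rule finite_subset) simp
  then have "\<not> inj y"
    using finite_imageD infinite_UNIV_nat by blast
  then obtain i j where "i \<noteq> j" "y i = y j"
    by (auto simp: inj_on_def)
  then show thesis
    using that by (cases i j rule: linorder_cases) auto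
qed

text \<open>Solving the expansion equation for \<open>- y (Suc k)\<close> gives the cycle relation
  for the negated values, and \<open>y i = y j\<close> closes the loop.\<close>

lemma is_cycle_of_expansion:
  assumes R: "R \<noteq> 0" and y: "\<And>k. d k \<in> L \<and> y k = R * y (Suc k) + d k"
    and ij: "i < j" "y i = y j"
  shows "is_cycle R L ((\<lambda>k. real_of_int (- y (i + k))) ` {..<j - i})"
  unfolding is_cycle_def
proof (intro exI[of _ "j - i"] exI[of _ "\<lambda>k. real_of_int (- y (i + k))"]
    exI[of _ "\<lambda>k. d (i + k)"] conjI allI impI)
  fix k assume k: "k < j - i"
  show "d (i + k) \<in> L"
    using y by simp
  \<comment> \<open>The index wraps only at the last point, where the two sides are
    \<open>y i\<close> and \<open>y j\<close>.\<close>
  have "y (i + (k + 1) mod (j - i)) = y (Suc (i + k))"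
  proof (cases "k + 1 = j - i")
    case True
    then show ?thesis
      using ij by (metis add.commute add_0 add_Suc_right le_add_diff_inverse less_imp_le
          mod_self Suc_eq_plus1)
  qed (use k in auto)
  moreover have "real_of_int (y (i + k)) = of_int R * of_int (y (Suc (i + k))) + of_int (d (i + k))"
    using y[of "i + k"] by (metis of_int_add of_int_mult)
  ultimately show "(real_of_int (- y (i + k)) + of_int (d (i + k))) / of_int R
      = real_of_int (- y (i + (k + 1) mod (j - i)))"
    using R by (simp add: field_simps)
qed (use ij in auto)

lemma Lambda_set_step:
  assumes "s \<in> Lambda_set R B L" and "l \<in> L"
  shows "of_int R * s + of_int l \<in> Lambda_set R B L"
  using Lambda_set_admissible[of R B L] assms unfolding Lambda_admissible_def by blast

lemma uminus_extreme_cycle_in_Lambda_set: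
  assumes "extreme_cycle R B L C" and "x \<in> C"
  shows "- x \<in> Lambda_set R B L"
  using Lambda_set_admissible[of R B L] assms unfolding Lambda_admissible_def by blast

lemma representable_in_Lambda_set:
  assumes R: "R \<ge> 2" and B: "finite B" "B \<noteq> {}" and L: "finite L"
    and x: "representable R L x"
  shows "of_int x \<in> Lambda_set R B L"
proof -
  obtain y d where y0: "y 0 = x" and y: "\<And>k. d k \<in> L \<and> y k = R * y (Suc k) + d k"
    using x unfolding representable_def by blast
  obtain i j where ij: "i < j" "y i = y j"
  proof (rule expansion_repeats[OF R])
    show "y k = R * y (Suc k) + d k" for k
      using y by blast
    show "range d \<subseteq> L"
      using y by blast
  qed (rule L)
  let ?C = "(\<lambda>k. real_of_int (- y (i + k))) ` {..<j - i}"
  have "extreme_cycle R B L ?C"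
  proof (rule extreme_cycle_of_int)
    show "is_cycle R L ?C"
      using R by (intro is_cycle_of_expansion[OF _ y ij]) simp
  qed (use B in auto)
  moreover have "real_of_int (- y i) \<in> ?C"
    using ij by (intro image_eqI[of _ _ 0]) auto
  ultimately have "- real_of_int (- y i) \<in> Lambda_set R B L"
    by (rule uminus_extreme_cycle_in_Lambda_set)
  then have "real_of_int (y i) \<in> Lambda_set R B L"
    by simp
  \<comment> \<open>Descent along the expansion: \<open>y i\<close> arises from
    \<open>y (Suc i)\<close> by one step \<open>R * s + l\<close> with digit
    \<open>d i\<close>.\<close>
  then have "real_of_int (y 0) \<in> Lambda_set R B L"
  proof (induction i)
    case (Suc i)
    from Lambda_set_step[OF Suc.prems, of "d i"] y[of i]
    have "real_of_int (y i) \<in> Lambda_set R B L"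
      by (metis of_int_add of_int_mult)
    then show ?case
      by (rule Suc.IH)
  qed
  then show ?thesis
    by (simp add: y0)
qed

text \<open>Integrality of the extreme cycles makes their negatives integers with periodic
  expansions; closure under \<open>R * s + l\<close> is prepending a digit.\<close>

lemma Lambda_admissible_representable:
  assumes R: "R \<noteq> 0" and C: "\<And>C. extreme_cycle R B L C \<Longrightarrow> C \<subseteq> \<int>"
  shows "Lambda_admissible R B L (of_int ` {x. representable R L x})"
  unfolding Lambda_admissible_def
proof (intro conjI allI impI subsetI)
  fix C z assume ext: "extreme_cycle R B L C" and "z \<in> uminus ` C"
  then obtain c where c: "z = of_int (- c)" "of_int c \<in> C"
    using C[OF ext] by (force elim!: Ints_cases)
  moreover have "representable R L (- c)"
    using ext C[OF ext] c R by (intro is_cycle_imp_representable) (auto simp: extreme_cycle_def)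
  ultimately show "z \<in> of_int ` {x. representable R L x}"
    by blast
next
  fix z assume "z \<in> {real_of_int R * s + of_int l | s l. s \<in> of_int ` {x. representable R L x} \<and> l \<in> L}"
  then obtain x l where "z = of_int (R * x + l)" "representable R L x" "l \<in> L"
    by auto
  then show "z \<in> of_int ` {x. representable R L x}"
    using representable_prepend by blast
qed

theorem proposition1p7:
  fixes R :: int and B L :: "int set"
  assumes "R \<ge> 2"
    and "Hadamard_pair R B L"
    and "\<And>C. extreme_cycle R B L C \<Longrightarrow> C \<subseteq> \<int>"
  shows "Lambda_set R B L = of_int ` {x :: int. representable R L x}"
proof
  \<comment> \<open>By minimality it suffices that the representable integers form an admissible
    set.\<close>
  show "Lambda_set R B L \<subseteq> of_int ` {x. representable R L x}"
    using assms by (intro Lambda_set_least Lambda_admissible_representable) auto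
  have "finite B" "B \<noteq> {}" "finite L"
    using assms(2) by (auto simp: Hadamard_pair_def)
  then show "of_int ` {x. representable R L x} \<subseteq> Lambda_set R B L"
    using assms(1) representable_in_Lambda_set by blast
qed

end
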